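(* Let $(\mathfrak{g}, [\,,],P_{\Omega})$ be a matching Lie Rota-Baxter algebra of weight $\lambda_\Omega$. Let $p \in Cent(\mathfrak{g})$ and set, for $x, y \in \mathfrak{g}$, $$[x, y]_p^1:= [p(x), y] \quad \text{and} \quad [x, y]_p^2:= [p(x), p(y)].$$ Assume that $p \circ P_{\omega}=P_{\omega} \circ p$ for each $\omega \in \Omega$. Then $(\mathfrak{g}, [\,,]_p^1,P_{\Omega}, p)$ and $(\mathfrak{g}, [\,,]_p^2,P_{\Omega},p)$ are matching Hom-Lie Rota-Baxter algebras of weight $\lambda_\Omega$.
   Context: Let $\mathbf{k}$ be a unitary commutative ring, the base ring of all modules and linear maps, and let $\Omega$ be a nonempty set. Let $\lambda_{\Omega}=(\lambda_{\omega})_{\omega \in \Omega}$ be a family of scalars in $\mathbf{k}$. A Hom-Lie algebra is a triple $(\mathfrak{g},[\,,],p)$ consisting of a $\mathbf{k}$-module $\mathfrak{g}$, a bilinear bracket $[\,,]:\mathfrak{g}\otimes\mathfrak{g}\to\mathfrak{g}$ with $[x,x]=0$ for all $x$ (hence skew-symmetric), and a linear map $p:\mathfrak{g}\to\mathfrak{g}$ satisfying $[p(x),[y,z]]+[p(y),[z,x]]+[p(z),[x,y]]=0$ for all $x,y,z\in\mathfrak{g}$. A matching Hom-Lie Rota-Baxter algebra $(\mathfrak{g},[\,,],P_\Omega,p)$ of weight $\lambda_\Omega$ is a Hom-Lie algebra $(\mathfrak{g}, [\,,],p)$ endowed with a family $P_\Omega=(P_\omega)_{\omega\in\Omega}$ of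 linear maps $P_{\omega} : \mathfrak{g} \rightarrow \mathfrak{g}$ such that $$[P_{\alpha}(x),P_{\beta}(y)] = P_{\alpha}([x, P_{\beta}(y)]) + P_{\beta}([P_{\alpha}(x), y])+ \lambda_{\beta} P_{\alpha}([x,y])\quad\text{for all } x,y\in\mathfrak{g},\ \alpha,\beta\in\Omega.$$ A matching Lie Rota-Baxter algebra $(\mathfrak{g},[\,,],P_\Omega)$ is the same with $p=\mathrm{id}$, i.e. a Lie algebra with linear maps $P_\omega$ satisfying the displayed equation. The centroid is $Cent(\mathfrak{g}) := \{p \in End(\mathfrak{g}) : p[x, y] = [p(x), y]\ \forall x, y \in \mathfrak{g}\}$, where $End(\mathfrak{g})$ is the set of linear maps $\mathfrak{g}\to\mathfrak{g}$. *)

theory Defs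
  imports "HOL-Algebra.Module"
begin

text \<open>
  The base ring and the module are carrier-based, so the zero ring and the zero module are included.
  A \<open>module\<close> record carries the fields \<open>mult\<close> and \<open>one\<close> inherited from \<open>ring\<close>; they play
  no role, and the Lie bracket is a separate function.  All functions are only constrained
  on carriers.
\<close>

definition lin_End :: "('a, 'm) ring_scheme \<Rightarrow> ('a, 'b, 'n) module_scheme \<Rightarrow> ('b \<Rightarrow> 'b) set"
  where "lin_End R M =
    {f \<in> hom (add_monoid M) (add_monoid M).
       \<forall>a\<in>carrier R. \<forall>x\<in>carrier M. f (a \<odot>\<^bsub>M\<^esub> x) = a \<odot>\<^bsub>M\<^esub> f x}"

locale hom_lie_algebra = module R M for R (structure) and M (structure) +
  fixes bracket :: "'c \<Rightarrow> 'c \<Rightarrow> 'c" and p :: "'c \<Rightarrow> 'c"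
  assumes bracket_linear_right: "x \<in> carrier M \<Longrightarrow> (\<lambda>y. bracket x y) \<in> lin_End R M"
    and bracket_linear_left: "y \<in> carrier M \<Longrightarrow> (\<lambda>x. bracket x y) \<in> lin_End R M"
    and bracket_self: "x \<in> carrier M \<Longrightarrow> bracket x x = \<zero>\<^bsub>M\<^esub>"
    and twist_linear: "p \<in> lin_End R M"
    and hom_jacobi:
      "\<lbrakk>x \<in> carrier M; y \<in> carrier M; z \<in> carrier M\<rbrakk> \<Longrightarrow>
        bracket (p x) (bracket y z) \<oplus>\<^bsub>M\<^esub> bracket (p y) (bracket z x)
          \<oplus>\<^bsub>M\<^esub> bracket (p z) (bracket x y) = \<zero>\<^bsub>M\<^esub>"

locale matching_hom_lie_rota_baxter_algebra =
  hom_lie_algebra R M bracket p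
  for R (structure) and M (structure) and bracket and p +
  fixes \<Omega> :: "'i set" and wt :: "'i \<Rightarrow> 'a" and P :: "'i \<Rightarrow> 'c \<Rightarrow> 'c"
  assumes index_nonempty: "\<Omega> \<noteq> {}"
    and weight_closed: "\<omega> \<in> \<Omega> \<Longrightarrow> wt \<omega> \<in> carrier R"
    and operator_linear: "\<omega> \<in> \<Omega> \<Longrightarrow> P \<omega> \<in> lin_End R M"
    and rota_baxter:
      "\<lbrakk>x \<in> carrier M; y \<in> carrier M; \<alpha> \<in> \<Omega>; \<beta> \<in> \<Omega>\<rbrakk> \<Longrightarrow>
        bracket (P \<alpha> x) (P \<beta> y) =
          P \<alpha> (bracket x (P \<beta> y)) \<oplus>\<^bsub>M\<^esub> P \<beta> (bracket (P \<alpha> x) y)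
            \<oplus>\<^bsub>M\<^esub> wt \<beta> \<odot>\<^bsub>M\<^esub> P \<alpha> (bracket x y)"

locale matching_lie_rota_baxter_algebra =
  matching_hom_lie_rota_baxter_algebra R M bracket id \<Omega> wt P
  for R (structure) and M (structure) and bracket and \<Omega> and wt and P

definition centroid ::
  "('a, 'm) ring_scheme \<Rightarrow> ('a, 'b, 'n) module_scheme \<Rightarrow> ('b \<Rightarrow> 'b \<Rightarrow> 'b) \<Rightarrow> ('b \<Rightarrow> 'b) set"
  where "centroid R M bracket =
    {p \<in> lin_End R M. \<forall>x\<in>carrier M. \<forall>y\<in>carrier M. p (bracket x y) = bracket (p x) y}"

end

theory Submission
  imports Defs
begin

text \<open>
  Every element \<open>q\<close> of the centroid is linear over the bracket in either argument,
  \<open>q [x, y] = [q x, y] = [x, q y]\<close>: the first equality is the definition and the second follows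
  from it by skew-symmetry.  Hence both brackets of the theorem have, on the carrier, the form
  \<open>q [x, y]\<close> with \<open>q\<close> in the centroid: \<open>q = p\<close> for the first and \<open>q = p \<circ> p\<close> for the second.

  So it suffices to show that \<open>q [x, y]\<close> is a matching Hom-Lie Rota-Baxter bracket with twist \<open>p\<close>
  whenever \<open>p\<close> and \<open>q\<close> lie in the centroid and \<open>q\<close> commutes with the operators
  (lemma \<open>centroid_twist\<close>).  Both remaining identities are then linear images of known ones: by
  centrality, each term of the Hom-Jacobi sum is \<open>q (q (p [x, [y, z]]))\<close> up to a cyclic permutation,
  so the sum is the image of the Jacobi identity under \<open>q \<circ> q \<circ> p\<close>; and the Rota-Baxter identity
  of the new bracket is the image of the old one under \<open>q\<close>, because \<open>q\<close> passes through the operators.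
\<close>

lemma lin_EndI:
  assumes "\<And>x. x \<in> carrier M \<Longrightarrow> f x \<in> carrier M"
    and "\<And>x y. \<lbrakk>x \<in> carrier M; y \<in> carrier M\<rbrakk> \<Longrightarrow> f (x \<oplus>\<^bsub>M\<^esub> y) = f x \<oplus>\<^bsub>M\<^esub> f y"
    and "\<And>a x. \<lbrakk>a \<in> carrier R; x \<in> carrier M\<rbrakk> \<Longrightarrow> f (a \<odot>\<^bsub>M\<^esub> x) = a \<odot>\<^bsub>M\<^esub> f x"
  shows "f \<in> lin_End R M"
  using assms by (auto simp: lin_End_def hom_def)

lemma
  assumes "f \<in> lin_End R M"
  shows lin_End_closed: "x \<in> carrier M \<Longrightarrow> f x \<in> carrier M"
    and lin_End_add:
      "\<lbrakk>x \<in> carrier M; y \<in> carrier M\<rbrakk> \<Longrightarrow> f (x \<oplus>\<^bsub>M\<^esub> y) = f x \<oplus>\<^bsub>M\<^esub> f y"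
    and lin_End_smult:
      "\<lbrakk>a \<in> carrier R; x \<in> carrier M\<rbrakk> \<Longrightarrow> f (a \<odot>\<^bsub>M\<^esub> x) = a \<odot>\<^bsub>M\<^esub> f x"
  using assms by (auto simp: lin_End_def hom_def)

lemma lin_End_comp:
  assumes "f \<in> lin_End R M" "g \<in> lin_End R M"
  shows "(\<lambda>x. f (g x)) \<in> lin_End R M"
  by (rule lin_EndI)
    (simp_all add: lin_End_closed[OF assms(1)] lin_End_closed[OF assms(2)]
      lin_End_add[OF assms(1)] lin_End_add[OF assms(2)]
      lin_End_smult[OF assms(1)] lin_End_smult[OF assms(2)])

text \<open>
  Membership in \<open>lin_End\<close> constrains a function on the carrier only, so a bracket that is known only
  there can be replaced by an equal one.
\<close>

lemma lin_End_cong: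
  assumes "module R M" and "f \<in> lin_End R M"
    and eq: "\<And>x. x \<in> carrier M \<Longrightarrow> g x = f x"
  shows "g \<in> lin_End R M"
proof -
  interpret module R M by fact
  show ?thesis
    by (rule lin_EndI)
      (simp_all add: eq lin_End_closed[OF assms(2)] lin_End_add[OF assms(2)]
        lin_End_smult[OF assms(2)])
qed

lemma lin_End_zero:
  assumes "module R M" and f: "f \<in> lin_End R M"
  shows "f \<zero>\<^bsub>M\<^esub> = \<zero>\<^bsub>M\<^esub>"
proof -
  interpret module R M by fact
  have "f \<zero>\<^bsub>M\<^esub> \<oplus>\<^bsub>M\<^esub> f \<zero>\<^bsub>M\<^esub> = f \<zero>\<^bsub>M\<^esub>"
    using lin_End_add[OF f, of "\<zero>\<^bsub>M\<^esub>" "\<zero>\<^bsub>M\<^esub>"] by simp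
  then show ?thesis
    using lin_End_closed[OF f, of "\<zero>\<^bsub>M\<^esub>"] by (metis M.add.r_cancel_one M.zero_closed)
qed

context hom_lie_algebra
begin

lemma bracket_closed:
  "\<lbrakk>x \<in> carrier M; y \<in> carrier M\<rbrakk> \<Longrightarrow> bracket x y \<in> carrier M"
  using lin_End_closed[OF bracket_linear_right] .

text \<open>Skew-symmetry is the polarisation of \<open>[x, x] = 0\<close> at \<open>x + y\<close>.\<close>

lemma bracket_skew:
  assumes x: "x \<in> carrier M" and y: "y \<in> carrier M"
  shows "bracket x y = \<ominus>\<^bsub>M\<^esub> bracket y x"
proof -
  have "\<zero>\<^bsub>M\<^esub> = bracket (x \<oplus>\<^bsub>M\<^esub> y) (x \<oplus>\<^bsub>M\<^esub> y)"
    using x y by (simp add: bracket_self)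
  also have "\<dots> = bracket x (x \<oplus>\<^bsub>M\<^esub> y) \<oplus>\<^bsub>M\<^esub> bracket y (x \<oplus>\<^bsub>M\<^esub> y)"
    using lin_End_add[OF bracket_linear_left] x y by simp
  also have "\<dots> = bracket x y \<oplus>\<^bsub>M\<^esub> bracket y x"
    using lin_End_add[OF bracket_linear_right] x y by (simp add: bracket_self bracket_closed)
  finally show ?thesis
    using x y bracket_closed by (metis M.minus_equality)
qed

lemma centroid_left:
  assumes "q \<in> centroid R M bracket" "x \<in> carrier M" "y \<in> carrier M"
  shows "bracket (q x) y = q (bracket x y)"
  using assms by (simp add: centroid_def)

lemma centroid_right:
  assumes q: "q \<in> centroid R M bracket" and x: "x \<in> carrier M" and y: "y \<in> carrier M"
  shows "bracket x (q y) = q (bracket x y)"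
proof -
  have lin: "q \<in> lin_End R M"
    using q by (simp add: centroid_def)
  have "q (bracket x y) \<oplus>\<^bsub>M\<^esub> q (bracket y x) = q (bracket x y \<oplus>\<^bsub>M\<^esub> bracket y x)"
    using lin_End_add[OF lin] x y bracket_closed by simp
  also have "\<dots> = \<zero>\<^bsub>M\<^esub>"
    using bracket_skew[OF x y] x y bracket_closed lin_End_zero[OF module_axioms lin]
    by (simp add: M.l_neg)
  finally have "\<ominus>\<^bsub>M\<^esub> q (bracket y x) = q (bracket x y)"
    using lin_End_closed[OF lin] x y bracket_closed by (metis M.minus_equality)
  then show ?thesis
    using bracket_skew[OF x lin_End_closed[OF lin y]] centroid_left[OF q y x] by simp
qed

lemma centroid_comp:
  assumes p: "p' \<in> centroid R M bracket" and q: "q \<in> centroid R M bracket"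
  shows "(\<lambda>x. p' (q x)) \<in> centroid R M bracket"
proof -
  have p_lin: "p' \<in> lin_End R M" and q_lin: "q \<in> lin_End R M"
    using p q by (simp_all add: centroid_def)
  show ?thesis
    by (simp add: centroid_def lin_End_comp[OF p_lin q_lin] lin_End_closed[OF q_lin]
        centroid_left[OF p] centroid_left[OF q])
qed

end

text \<open>
  The new bracket \<open>br\<close> is prescribed on the carrier only: the brackets \<open>[p x, p y]\<close> and
  \<open>p (p [x, y])\<close> may differ elsewhere.  Allowing \<open>q\<close> to differ from the twist \<open>p\<close> lets one argument
  serve both brackets of the theorem.
\<close>

lemma (in matching_lie_rota_baxter_algebra) centroid_twist:
  assumes p: "p \<in> centroid R M bracket" and q: "q \<in> centroid R M bracket"
    and comm: "\<And>\<omega> x. \<lbrakk>\<omega> \<in> \<Omega>; x \<in> carrier M\<rbrakk> \<Longrightarrow> q (P \<omega> x) = P \<omega> (q x)"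
    and br: "\<And>x y. \<lbrakk>x \<in> carrier M; y \<in> carrier M\<rbrakk> \<Longrightarrow> br x y = q (bracket x y)"
  shows "matching_hom_lie_rota_baxter_algebra R M br p \<Omega> wt P"
proof -
  have p_lin: "p \<in> lin_End R M" and q_lin: "q \<in> lin_End R M"
    using p q by (simp_all add: centroid_def)
  note p_closed = lin_End_closed[OF p_lin]
  note q_closed = lin_End_closed[OF q_lin]
  note P_closed = lin_End_closed[OF operator_linear]
  have lie_jacobi: "bracket x (bracket y z) \<oplus>\<^bsub>M\<^esub> bracket y (bracket z x)
      \<oplus>\<^bsub>M\<^esub> bracket z (bracket x y) = \<zero>\<^bsub>M\<^esub>"
    if "x \<in> carrier M" "y \<in> carrier M" "z \<in> carrier M" for x y z
    using hom_jacobi[OF that] by simp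
  show ?thesis
  proof
    fix x assume x: "x \<in> carrier M"
    show "(\<lambda>y. br x y) \<in> lin_End R M"
      by (rule lin_End_cong[OF module_axioms lin_End_comp[OF q_lin bracket_linear_right[OF x]]])
        (simp add: br x)
    show "(\<lambda>y. br y x) \<in> lin_End R M"
      by (rule lin_End_cong[OF module_axioms lin_End_comp[OF q_lin bracket_linear_left[OF x]]])
        (simp add: br x)
    show "br x x = \<zero>\<^bsub>M\<^esub>"
      using br x bracket_self lin_End_zero[OF module_axioms q_lin] by simp
  next
    show "p \<in> lin_End R M" by (rule p_lin)
  next
    fix x y z assume xyz: "x \<in> carrier M" "y \<in> carrier M" "z \<in> carrier M"
    have cyclic_term: "br (p u) (br v w) = q (q (p (bracket u (bracket v w))))"
      if "u \<in> carrier M" "v \<in> carrier M" "w \<in> carrier M" for u v w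
      using that by (simp add: br p_closed q_closed bracket_closed
          centroid_left[OF p] centroid_right[OF q])
    have "br (p x) (br y z) \<oplus>\<^bsub>M\<^esub> br (p y) (br z x) \<oplus>\<^bsub>M\<^esub> br (p z) (br x y) =
        q (q (p (bracket x (bracket y z) \<oplus>\<^bsub>M\<^esub> bracket y (bracket z x)
          \<oplus>\<^bsub>M\<^esub> bracket z (bracket x y))))"
      using xyz by (simp add: cyclic_term p_closed q_closed bracket_closed
          lin_End_add[OF p_lin] lin_End_add[OF q_lin])
    also have "\<dots> = \<zero>\<^bsub>M\<^esub>"
      using lie_jacobi[OF xyz] lin_End_zero[OF module_axioms p_lin]
        lin_End_zero[OF module_axioms q_lin] by simp
    finally show "br (p x) (br y z) \<oplus>\<^bsub>M\<^esub> br (p y) (br z x) \<oplus>\<^bsub>M\<^esub> br (p z) (br x y) = \<zero>\<^bsub>M\<^esub>" .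
  next
    show "\<Omega> \<noteq> {}" by (rule index_nonempty)
  next
    fix \<omega> assume "\<omega> \<in> \<Omega>"
    then show "wt \<omega> \<in> carrier R" and "P \<omega> \<in> lin_End R M"
      by (rule weight_closed, rule operator_linear)
  next
    fix x y \<alpha> \<beta>
    assume xy: "x \<in> carrier M" "y \<in> carrier M" and ab: "\<alpha> \<in> \<Omega>" "\<beta> \<in> \<Omega>"
    have "br (P \<alpha> x) (P \<beta> y) = q (bracket (P \<alpha> x) (P \<beta> y))"
      using xy ab by (simp add: br P_closed)
    also have "\<dots> = q (P \<alpha> (bracket x (P \<beta> y)) \<oplus>\<^bsub>M\<^esub> P \<beta> (bracket (P \<alpha> x) y)
        \<oplus>\<^bsub>M\<^esub> wt \<beta> \<odot>\<^bsub>M\<^esub> P \<alpha> (bracket x y))"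
      using xy ab by (simp add: rota_baxter)
    also have "\<dots> = P \<alpha> (q (bracket x (P \<beta> y))) \<oplus>\<^bsub>M\<^esub> P \<beta> (q (bracket (P \<alpha> x) y))
        \<oplus>\<^bsub>M\<^esub> wt \<beta> \<odot>\<^bsub>M\<^esub> P \<alpha> (q (bracket x y))"
      using xy ab by (simp add: P_closed bracket_closed weight_closed comm
          lin_End_add[OF q_lin] lin_End_smult[OF q_lin])
    also have "\<dots> = P \<alpha> (br x (P \<beta> y)) \<oplus>\<^bsub>M\<^esub> P \<beta> (br (P \<alpha> x) y)
        \<oplus>\<^bsub>M\<^esub> wt \<beta> \<odot>\<^bsub>M\<^esub> P \<alpha> (br x y)"
      using xy ab by (simp add: br P_closed)
    finally show "br (P \<alpha> x) (P \<beta> y) = P \<alpha> (br x (P \<beta> y)) \<oplus>\<^bsub>M\<^esub> P \<beta> (br (P \<alpha> x) y)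
        \<oplus>\<^bsub>M\<^esub> wt \<beta> \<odot>\<^bsub>M\<^esub> P \<alpha> (br x y)" .
  qed
qed

theorem proposition5p6:
  fixes R :: "('a, 'm) ring_scheme"
    and \<gg> :: "('a, 'b, 'n) module_scheme"
    and bracket :: "'b \<Rightarrow> 'b \<Rightarrow> 'b"
    and \<Omega> :: "'i set"
    and wt :: "'i \<Rightarrow> 'a"
    and P :: "'i \<Rightarrow> 'b \<Rightarrow> 'b"
    and p :: "'b \<Rightarrow> 'b"
  assumes "matching_lie_rota_baxter_algebra R \<gg> bracket \<Omega> wt P"
    and "p \<in> centroid R \<gg> bracket"
    and "\<And>\<omega> x. \<lbrakk>\<omega> \<in> \<Omega>; x \<in> carrier \<gg>\<rbrakk> \<Longrightarrow> p (P \<omega> x) = P \<omega> (p x)"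
  shows "matching_hom_lie_rota_baxter_algebra R \<gg> (\<lambda>x y. bracket (p x) y) p \<Omega> wt P
    \<and> matching_hom_lie_rota_baxter_algebra R \<gg> (\<lambda>x y. bracket (p x) (p y)) p \<Omega> wt P"
proof -
  interpret matching_lie_rota_baxter_algebra R \<gg> bracket \<Omega> wt P by fact
  note p = assms(2) and comm = assms(3)
  have "p \<in> lin_End R \<gg>"
    using p by (simp add: centroid_def)
  note p_closed = lin_End_closed[OF this]
  have "matching_hom_lie_rota_baxter_algebra R \<gg> (\<lambda>x y. bracket (p x) y) p \<Omega> wt P"
    by (rule centroid_twist[OF p p]) (simp_all add: comm centroid_left[OF p])
  moreover
  have "matching_hom_lie_rota_baxter_algebra R \<gg> (\<lambda>x y. bracket (p x) (p y)) p \<Omega> wt P"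
    by (rule centroid_twist[OF p centroid_comp[OF p p]])
      (simp_all add: comm p_closed centroid_left[OF p] centroid_right[OF p])
  ultimately show ?thesis ..
qed

end
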